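(* Let $[a,b]$ be a real interval, let $\alpha,\beta\in\mathbb{C}$ with $\operatorname{Re}(\alpha)>0$ and $\operatorname{Re}(\beta)>0$, and let $R\in\mathbb{R}^+$ satisfy $R>(b-a)^{\operatorname{Re}(\beta)}$. Let $\mathcal{A}(x)=\sum_{n=0}^\infty a_nx^n$ be analytic on the complex disc $\mathcal{D}(0,R)$, the power series being locally uniformly convergent there. Let $\varphi\in C^1[a,b]$ be a monotonic function which is Lipschitz continuous, and let $u\in L^1_\varphi[a,b]$. Then the generalised fractional integral of $u$, with analytic kernel $\mathcal{A}$ and with respect to $\varphi$, is given by a locally uniformly convergent series as follows: $${}^{\mathcal{A}}_{a}I^{\alpha,\beta}_{\varphi(x)}u(x)=\sum_{n=0}^{\infty}a_n\,\Gamma(\beta n+\alpha)\;{}^{RL}_{a}I^{\beta n+\alpha}_{\varphi(x)}u(x).$$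
   Context: $L^1_\varphi[a,b]$ is the space of Lebesgue measurable $u:[a,b]\to\mathbb{C}$ with $\int_a^b|u(x)|\varphi'(x)\,dx<\infty$. The generalised fractional integral of $u$ with analytic kernel $\mathcal{A}$ with respect to $\varphi$ is $${}^{\mathcal{A}}_{a}I^{\alpha,\beta}_{\varphi(x)}u(x)=\int_a^x\varphi'(t)\,[\varphi(x)-\varphi(t)]^{\alpha-1}\,\mathcal{A}\big([\varphi(x)-\varphi(t)]^{\beta}\big)\,u(t)\,dt .$$ The coefficients $a_n=a_n(\alpha,\beta)$ of $\mathcal{A}$ may depend on $\alpha,\beta$. For $\mu\in\mathbb{C}$ with $\operatorname{Re}(\mu)>0$, the Riemann--Liouville fractional integral of order $\mu$ with respect to $\varphi$ is $${}^{RL}_{a}I^{\mu}_{\varphi(x)}u(x)=\frac{1}{\Gamma(\mu)}\int_a^x\varphi'(t)[\varphi(x)-\varphi(t)]^{\mu-1}u(t)\,dt .$$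
   Formalization: The identity is asserted not on all of [a,b] but at every x where [φ(x)−φ(t)]^β stays in D(0,R) for all t in [a,x] and the left integral converges absolutely; almost every x of the first kind with φ'(x)≠0 qualifies. For decreasing φ, L¹_φ uses |φ'|. *)

theory Defs
  imports "HOL-Analysis.Analysis"
begin

text \<open>
  In all definitions \<open>\<phi>'\<close> stands for the derivative of \<open>\<phi>\<close>; it is an explicit argument because at
  the end points of \<open>[a,b]\<close> only a one-sided derivative is available.  Complex powers are
  taken with the principal branch, so they are also defined when \<open>\<phi> x - \<phi> t < 0\<close>.
\<close>

definition L1_wrt :: "real \<Rightarrow> real \<Rightarrow> (real \<Rightarrow> real) \<Rightarrow> (real \<Rightarrow> complex) set" where
  "L1_wrt a b \<phi>' =
     {u. u \<in> borel_measurable (lebesgue_on {a..b}) \<and>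
         (\<lambda>x. cmod (u x) * \<phi>' x) absolutely_integrable_on {a..b}}"

definition kernel_integrand ::
  "(complex \<Rightarrow> complex) \<Rightarrow> complex \<Rightarrow> complex \<Rightarrow> (real \<Rightarrow> real) \<Rightarrow> (real \<Rightarrow> real)
    \<Rightarrow> (real \<Rightarrow> complex) \<Rightarrow> real \<Rightarrow> real \<Rightarrow> complex" where
  "kernel_integrand A \<alpha> \<beta> \<phi> \<phi>' u x t =
     of_real (\<phi>' t) * of_real (\<phi> x - \<phi> t) powr (\<alpha> - 1)
       * A (of_real (\<phi> x - \<phi> t) powr \<beta>) * u t"

definition kernel_integral ::
  "real \<Rightarrow> (complex \<Rightarrow> complex) \<Rightarrow> complex \<Rightarrow> complex \<Rightarrow> (real \<Rightarrow> real) \<Rightarrow> (real \<Rightarrow> real)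
    \<Rightarrow> (real \<Rightarrow> complex) \<Rightarrow> real \<Rightarrow> complex" where
  "kernel_integral a A \<alpha> \<beta> \<phi> \<phi>' u x =
     (LINT t:{a..x}|lebesgue. kernel_integrand A \<alpha> \<beta> \<phi> \<phi>' u x t)"

definition RL_integrand ::
  "complex \<Rightarrow> (real \<Rightarrow> real) \<Rightarrow> (real \<Rightarrow> real) \<Rightarrow> (real \<Rightarrow> complex) \<Rightarrow> real \<Rightarrow> real \<Rightarrow> complex" where
  "RL_integrand \<mu> \<phi> \<phi>' u x t =
     of_real (\<phi>' t) * of_real (\<phi> x - \<phi> t) powr (\<mu> - 1) * u t"

definition RL_integral ::
  "real \<Rightarrow> complex \<Rightarrow> (real \<Rightarrow> real) \<Rightarrow> (real \<Rightarrow> real) \<Rightarrow> (real \<Rightarrow> complex) \<Rightarrow> real \<Rightarrow> complex" where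
  "RL_integral a \<mu> \<phi> \<phi>' u x =
     1 / Gamma \<mu> * (LINT t:{a..x}|lebesgue. RL_integrand \<mu> \<phi> \<phi>' u x t)"

text \<open>
  The points \<open>x\<close> at which every argument passed to a kernel on the disc of radius \<open>R\<close> lies in
  that disc.  If \<open>\<phi>\<close> is increasing with Lipschitz constant at most 1 and
  \<open>R > (b - a) powr Re \<beta>\<close>, this is all of \<open>[a,b]\<close>; for larger constants it need not be.
\<close>

definition kernel_admissible ::
  "real \<Rightarrow> real \<Rightarrow> real \<Rightarrow> complex \<Rightarrow> (real \<Rightarrow> real) \<Rightarrow> real set" where
  "kernel_admissible a b R \<beta> \<phi> =
     {x \<in> {a..b}. \<forall>t\<in>{a..x}. complex_of_real (\<phi> x - \<phi> t) powr \<beta> \<in> ball 0 R}"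

text \<open>
  The points at which the generalised integral is meaningful.  For \<open>Re \<alpha> < 1\<close> and
  \<open>u \<in> L1_wrt a b \<phi>'\<close> the singular integral may diverge at some points, as for any convolution
  of \<open>L\<^sup>1\<close> functions, and there \<open>kernel_integral\<close> takes the default value 0.
\<close>

definition kernel_domain ::
  "real \<Rightarrow> real \<Rightarrow> real \<Rightarrow> (complex \<Rightarrow> complex) \<Rightarrow> complex \<Rightarrow> complex
    \<Rightarrow> (real \<Rightarrow> real) \<Rightarrow> (real \<Rightarrow> real) \<Rightarrow> (real \<Rightarrow> complex) \<Rightarrow> real set" where
  "kernel_domain a b R A \<alpha> \<beta> \<phi> \<phi>' u =
     {x \<in> kernel_admissible a b R \<beta> \<phi>.
        kernel_integrand A \<alpha> \<beta> \<phi> \<phi>' u x absolutely_integrable_on {a..x}}"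

definition sums_locally_uniformly_on ::
  "'a::metric_space set \<Rightarrow> (nat \<Rightarrow> 'a \<Rightarrow> 'b::real_normed_vector) \<Rightarrow> ('a \<Rightarrow> 'b) \<Rightarrow> bool" where
  "sums_locally_uniformly_on S f F \<longleftrightarrow>
     (\<forall>x\<in>S. \<exists>e>0. uniform_limit (ball x e \<inter> S) (\<lambda>N y. \<Sum>n<N. f n y) F sequentially)"

end

theory Submission
  imports Defs
begin

text \<open>
  Write \<open>w = (\<phi> x - \<phi> t) powr \<beta>\<close>.  For a fixed \<open>k\<close> with \<open>k Re \<beta> + Re \<alpha> \<ge> 1\<close> and
  \<open>\<bar>w\<bar> \<le> r < R\<close>, the tail of the power series after \<open>N \<ge> k\<close> terms is at most
  \<open>E\<^sub>N (\<bar>w\<bar> / r)\<^sup>k\<close> with \<open>E\<^sub>N \<rightarrow> 0\<close>.  The factor \<open>\<bar>w\<bar>\<^sup>k\<close> absorbs the singularity of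
  \<open>(\<phi> x - \<phi> t) powr (\<alpha> - 1)\<close>, so the remainder integral is at most a constant times
  \<open>E\<^sub>N \<integral> \<bar>\<phi>'\<bar> \<bar>u\<bar>\<close>, uniformly for \<open>x\<close> near a given point.  Conversely \<open>A\<close> is bounded below
  near 0 by a multiple of \<open>\<bar>w\<bar>\<^sup>k\<close>, where \<open>k\<close> is its order of vanishing, so integrability of the
  kernel passes to every term of the series.  Almost everywhere existence follows from Tonelli's
  theorem applied to \<open>\<phi>'(x) \<phi>'(t) \<bar>\<phi> x - \<phi> t\<bar> powr (Re \<alpha> - 1) \<bar>u t\<bar>\<close>, the \<open>x\<close>-integral
  being elementary.
\<close>

section \<open>Power series: uniform tails and order of vanishing at 0\<close>

text \<open>\<open>E N\<close> is the tail of the sum of \<open>cmod (c n) * r ^ n\<close>. Each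
  term of the remainder carries \<open>(cmod z / r) ^ (n + N)\<close>, a power of a ratio at most 1,
  so its exponent may be lowered to any \<open>k \<le> N\<close>. The same \<open>E\<close> serves
  every \<open>k\<close>.\<close>

lemma power_series_tail_bound:
  fixes c :: "nat \<Rightarrow> complex" and A :: "complex \<Rightarrow> complex"
  assumes sums: "\<And>z. cmod z < R \<Longrightarrow> (\<lambda>n. c n * z ^ n) sums A z"
    and r: "0 < r" "r < R"
  obtains E where "E \<longlonglongrightarrow> 0" "\<And>N. 0 \<le> E N"
    "\<And>k N z. k \<le> N \<Longrightarrow> cmod z \<le> r \<Longrightarrow>
       cmod (A z - (\<Sum>n<N. c n * z ^ n)) \<le> E N * (cmod z / r) ^ k"
proof -
  define a where "a n = cmod (c n) * r ^ n" for n
  define E where "E N = (\<Sum>n. a (n + N))" for N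
  \<comment> \<open>Convergence at a point strictly between \<open>r\<close> and \<open>R\<close>
    yields absolute convergence at \<open>r\<close>.\<close>
  obtain \<rho> where \<rho>: "r < \<rho>" "\<rho> < R" using dense[OF r(2)] by blast
  have "summable (\<lambda>n. c n * of_real \<rho> ^ n)"
    by (rule sums_summable[OF sums]) (use r \<rho> in simp)
  then have "summable (\<lambda>n. cmod (c n * of_real r ^ n))"
    by (rule powser_insidea) (use r \<rho> in simp)
  then have a: "summable a"
    using r by (simp add: a_def[abs_def] norm_mult norm_power)
  have a_nonneg: "0 \<le> a n" for n
    using r by (simp add: a_def)
  have a_shift: "summable (\<lambda>n. a (n + N))" for N
    using a by (simp add: summable_iff_shift)
  have "E = (\<lambda>N. suminf a - (\<Sum>n<N. a n))"
    unfolding E_def by (rule ext) (rule suminf_minus_initial_segment[OF a])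
  moreover have "(\<lambda>N. suminf a - (\<Sum>n<N. a n)) \<longlonglongrightarrow> suminf a - suminf a"
    using a by (intro tendsto_intros summable_LIMSEQ)
  ultimately have "E \<longlonglongrightarrow> 0"
    by simp
  moreover have "0 \<le> E N" for N
    unfolding E_def using a_shift a_nonneg by (intro suminf_nonneg) auto
  moreover have "cmod (A z - (\<Sum>n<N. c n * z ^ n)) \<le> E N * (cmod z / r) ^ k"
    if kN: "k \<le> N" and z: "cmod z \<le> r" for k N z
  proof -
    have bound: "cmod (c (n + N) * z ^ (n + N)) \<le> a (n + N) * (cmod z / r) ^ k" for n
    proof -
      have "cmod (c (n + N) * z ^ (n + N)) = a (n + N) * (cmod z / r) ^ (n + N)"
        using r by (simp add: a_def norm_mult norm_power power_divide)
      also have "\<dots> \<le> a (n + N) * (cmod z / r) ^ k"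
        using r z kN a_nonneg by (intro mult_left_mono power_decreasing) auto
      finally show ?thesis .
    qed
    have sm: "summable (\<lambda>n. a (n + N) * (cmod z / r) ^ k)"
      by (intro summable_mult2 a_shift)
    have "(\<lambda>n. c n * z ^ n) sums A z"
      using sums z r by simp
    then have "A z - (\<Sum>n<N. c n * z ^ n) = (\<Sum>n. c (n + N) * z ^ (n + N))"
      by (subst suminf_minus_initial_segment) (auto simp: sums_iff)
    also have "cmod \<dots> \<le> (\<Sum>n. a (n + N) * (cmod z / r) ^ k)"
      by (rule norm_suminf_le[OF bound sm])
    also have "\<dots> = E N * (cmod z / r) ^ k"
      unfolding E_def by (rule suminf_mult2[symmetric, OF a_shift])
    finally show ?thesis .
  qed
  ultimately show thesis
    using that by blast
qed

text \<open>Near 0 the term of order \<open>k\<close> dominates: what follows it is at most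
  \<open>e * cmod z ^ Suc k\<close>, which for \<open>cmod z \<le> \<delta>\<close> is at most half
  of the leading term.\<close>

lemma power_series_lower_bound:
  fixes c :: "nat \<Rightarrow> complex" and A :: "complex \<Rightarrow> complex"
  assumes sums: "\<And>z. cmod z < R \<Longrightarrow> (\<lambda>n. c n * z ^ n) sums A z"
    and R: "0 < R" and k: "c k \<noteq> 0" "\<And>n. n < k \<Longrightarrow> c n = 0"
  obtains \<delta> K where "0 < \<delta>" "0 < K" "\<And>z. cmod z \<le> \<delta> \<Longrightarrow> cmod z ^ k \<le> K * cmod (A z)"
proof -
  define r where "r = R / 2"
  have r: "0 < r" "r < R" using R by (auto simp: r_def)
  obtain E where E0: "\<And>N. 0 \<le> E N"
    and E: "\<And>k N z. k \<le> N \<Longrightarrow> cmod z \<le> r \<Longrightarrow>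
       cmod (A z - (\<Sum>n<N. c n * z ^ n)) \<le> E N * (cmod z / r) ^ k"
    using power_series_tail_bound[of R c A, OF sums r] by metis
  \<comment> \<open>The summand 1 keeps \<open>e\<close> positive even if the tail vanishes, so that
    \<open>\<delta>\<close> may divide by it.\<close>
  define e where "e = E (Suc k) / r ^ Suc k + 1"
  have e: "e > 0" using E0[of "Suc k"] r by (auto simp: e_def intro!: add_nonneg_pos)
  define \<delta> where "\<delta> = min r (cmod (c k) / (2 * e))"
  have \<delta>: "\<delta> > 0" using r k e by (auto simp: \<delta>_def)
  have "cmod z ^ k \<le> 2 / cmod (c k) * cmod (A z)" if z: "cmod z \<le> \<delta>" for z
  proof -
    have "(\<Sum>n<Suc k. c n * z ^ n) = c k * z ^ k"
      using k(2) by simp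
    then have "cmod (A z - c k * z ^ k) \<le> E (Suc k) * (cmod z / r) ^ Suc k"
      using E[of "Suc k" "Suc k" z] z by (simp add: \<delta>_def)
    also have "\<dots> = (E (Suc k) / r ^ Suc k) * cmod z * cmod z ^ k"
      by (simp add: power_divide field_simps)
    also have "\<dots> \<le> e * cmod z * cmod z ^ k"
      by (intro mult_right_mono) (auto simp: e_def)
    also have "\<dots> \<le> e * (cmod (c k) / (2 * e)) * cmod z ^ k"
      using z e by (intro mult_right_mono mult_left_mono) (auto simp: \<delta>_def)
    also have "\<dots> = cmod (c k) / 2 * cmod z ^ k" using e by simp
    finally have 1: "cmod (A z - c k * z ^ k) \<le> cmod (c k) / 2 * cmod z ^ k" .
    have "cmod (c k) * cmod z ^ k = cmod (c k * z ^ k)"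
      by (simp add: norm_mult norm_power)
    also have "\<dots> \<le> cmod (A z) + cmod (A z - c k * z ^ k)"
      by (metis norm_minus_commute norm_triangle_sub)
    finally have "cmod (c k) * cmod z ^ k / 2 \<le> cmod (A z)"
      using 1 by simp
    then show ?thesis using k(1) by (simp add: field_simps)
  qed
  with \<delta> k show thesis using that[of \<delta> "2 / cmod (c k)"] by auto
qed

section \<open>Principal powers of real bases\<close>

text \<open>\<open>Ln\<close> jumps across the negative axis, so continuity is of no help there.
  Splitting by the sign of \<open>d\<close> leaves real logarithms, with \<open>\<i> * pi\<close>
  added for negative \<open>d\<close>.\<close>

lemma borel_measurable_complex_of_real_powr [measurable]:
  "(\<lambda>d::real. complex_of_real d powr s) \<in> borel_measurable borel"
proof -
  have "complex_of_real d powr s =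
      (if d = 0 then 0 else if d > 0 then exp (s * of_real (ln d))
       else exp (s * (of_real (ln (- d)) + \<i> * of_real pi)))" for d
    using Ln_of_real[of d] Ln_minus[of "of_real (- d)"] Ln_of_real[of "- d"] 
    by (auto simp: powr_def)
  then show ?thesis by simp
qed

lemma norm_complex_of_real_powr:
  "cmod (complex_of_real d powr s) = \<bar>d\<bar> powr Re s * (if d < 0 then exp (- pi * Im s) else 1)"
proof (cases "d = 0")
  case False
  then show ?thesis
    by (auto simp: norm_powr_complex Arg_of_real)
qed auto

text \<open>Both sides use the same \<open>Ln z\<close> and \<open>n\<close> is a natural number, so
  no change of branch can occur. At \<open>z = 0\<close> both sides vanish because
  \<open>0 powr s = 0\<close>, also for \<open>n = 0\<close>.\<close>

lemma powr_mult_of_nat_add: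
  fixes z \<alpha> \<beta> :: complex
  shows "z powr (\<beta> * of_nat n + \<alpha> - 1) = z powr (\<alpha> - 1) * (z powr \<beta>) ^ n"
proof (cases "z = 0")
  case False
  then have "z powr (\<beta> * of_nat n + \<alpha> - 1) = exp ((\<alpha> - 1) * Ln z + of_nat n * (\<beta> * Ln z))"
    by (simp add: powr_def algebra_simps)
  then show ?thesis
    using False by (simp only: exp_add exp_of_nat_mult powr_def if_False)
qed auto

section \<open>Almost everywhere finiteness of the singular integral\<close>

text \<open>The primitive \<open>(\<phi> x - \<phi> t) powr s / s\<close> is continuous since
  \<open>s > 0\<close>. It can fail to be differentiable inside the interval only at the last point
  where \<open>\<phi>\<close> still has the value \<open>\<phi> t\<close>, and the fundamental
  theorem tolerates one such point.\<close>

lemma powr_diff_has_integral: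
  fixes \<phi> :: "real \<Rightarrow> real"
  assumes deriv: "\<And>x. x \<in> {a..b} \<Longrightarrow> (\<phi> has_real_derivative \<phi>' x) (at x within {a..b})"
    and mono: "mono_on {a..b} \<phi>" and s: "s > 0" and t: "t \<in> {a..b}"
  shows "((\<lambda>x. \<phi>' x * (\<phi> x - \<phi> t) powr (s - 1)) has_integral (\<phi> b - \<phi> t) powr s / s) {t..b}"
proof -
  have cont: "continuous_on {a..b} \<phi>"
    using deriv by (rule DERIV_continuous_on)
  have cont_t: "continuous_on {t..b} \<phi>"
    by (rule continuous_on_subset[OF cont]) (use t in auto)
  have le: "\<phi> x \<le> \<phi> y" if "x \<in> {a..b}" "y \<in> {a..b}" "x \<le> y" for x y
    using mono that by (auto simp: mono_on_def)
  define S where "S = {t..b} \<inter> \<phi> -` {\<phi> t}"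
  have "closed S"
    unfolding S_def by (rule continuous_closed_preimage[OF cont_t]) auto
  then have "compact S"
    using bounded_subset[of "{t..b}" S] by (auto simp: S_def compact_eq_bounded_closed)
  moreover have "t \<in> S" using t by (auto simp: S_def)
  \<comment> \<open>Before \<open>c\<close> the map \<open>\<phi>\<close> is flat, and there \<open>0 powr (s - 1) = 0\<close> even if \<open>s < 1\<close>.\<close>
  ultimately obtain c where c: "c \<in> S" and cmax: "\<And>x. x \<in> S \<Longrightarrow> x \<le> c"
    using compact_attains_sup[of S] by blast
  have cS: "t \<le> c" "c \<le> b" "\<phi> c = \<phi> t" using c by (auto simp: S_def)
  define F where "F x = (\<phi> x - \<phi> t) powr s / s" for x
  have "((\<lambda>x. \<phi>' x * (\<phi> x - \<phi> t) powr (s - 1)) has_integral F b - F t) {t..b}"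
  proof (rule fundamental_theorem_of_calculus_interior_strong[of "{c}"])
    show "continuous_on {t..b} F"
      unfolding F_def
    proof (intro continuous_on_divide continuous_on_powr' continuous_on_diff cont_t continuous_on_const ballI conjI impI)
      show "0 \<le> \<phi> x - \<phi> t" if "x \<in> {t..b}" for x
        using le[of t x] t that by simp
    qed (use s in auto)
  next
    fix x assume x: "x \<in> {t<..<b} - {c}"
    consider "x < c" | "x > c" using x by fastforce
    then show "(F has_vector_derivative \<phi>' x * (\<phi> x - \<phi> t) powr (s - 1)) (at x)"
    proof cases
      case 1
      have flat: "\<phi> y = \<phi> t" if "y \<in> {t<..<c}" for y
        using le[of t y] le[of y c] that t cS by auto
      have "((\<lambda>y. 0) has_vector_derivative (0::real)) (at x)" by simp
      then have "(F has_vector_derivative 0) (at x)"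
        by (rule has_vector_derivative_transform_within_open[where S = "{t<..<c}"])
          (use x 1 flat in \<open>auto simp: F_def\<close>)
      then show ?thesis using flat[of x] x 1 by simp
    next
      case 2
      then have "x \<notin> S" using cmax[of x] by auto
      then have pos: "\<phi> x - \<phi> t > 0"
        using le[of t x] x t by (auto simp: S_def)
      have "(\<phi> has_real_derivative \<phi>' x) (at x)"
        using deriv[of x] x t at_within_interior[of x "{a..b}"] by (auto simp: interior_atLeastAtMost_real)
      then have d: "((\<lambda>x. \<phi> x - \<phi> t) has_real_derivative \<phi>' x) (at x)"
        by (auto intro!: derivative_eq_intros)
      have "(F has_real_derivative (s * (\<phi> x - \<phi> t) powr (s - 1) * \<phi>' x) / s) (at x)"
        unfolding F_def
        by (intro DERIV_cdivide DERIV_chain2[OF has_real_derivative_powr d] pos)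
      then show ?thesis using s
        by (simp add: has_real_derivative_iff_has_vector_derivative mult.commute)
    qed
  qed (use t in auto)
  then show ?thesis by (simp add: F_def)
qed

text \<open>After multiplication by \<open>\<phi>' x\<close> the integral in \<open>x\<close> is
  explicit and bounded by a multiple of \<open>g t\<close>. Tonelli then makes the integral in
  \<open>t\<close> finite for almost every \<open>x\<close>. Removing the factor again requires
  \<open>\<phi>' x \<noteq> 0\<close>.\<close>

lemma AE_powr_diff_integrable:
  fixes \<phi> :: "real \<Rightarrow> real"
  assumes deriv: "\<And>x. x \<in> {a..b} \<Longrightarrow> (\<phi> has_real_derivative \<phi>' x) (at x within {a..b})"
    and cont': "continuous_on {a..b} \<phi>'"
    and ab: "a < b" and mono: "mono_on {a..b} \<phi>" and s: "s > 0"
    and g: "g integrable_on {a..b}" and g0: "\<And>t. t \<in> {a..b} \<Longrightarrow> 0 \<le> g t"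
  shows "AE x in lebesgue. x \<in> {a..b} \<and> \<phi>' x \<noteq> 0 \<longrightarrow>
           (\<lambda>t. (\<phi> x - \<phi> t) powr (s - 1) * g t) integrable_on {a..x}"
proof -
  define M where "M = lebesgue_on {a..b}"
  have cont: "continuous_on {a..b} \<phi>"
    using deriv by (rule DERIV_continuous_on)
  have le: "\<phi> x \<le> \<phi> y" if "x \<in> {a..b}" "y \<in> {a..b}" "x \<le> y" for x y
    using mono that by (auto simp: mono_on_def)
  \<comment> \<open>Difference quotients of an increasing function are nonnegative;
    \<open>a < b\<close> makes the end points limit points as well, so the sign passes to the
    limit.\<close>
  have deriv_nonneg: "0 \<le> \<phi>' x" if x: "x \<in> {a..b}" for x
  proof (rule tendsto_lowerbound)
    show "((\<lambda>y. (\<phi> y - \<phi> x) / (y - x)) \<longlongrightarrow> \<phi>' x) (at x within {a..b})"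
      using deriv[OF x] by (simp add: has_field_derivative_iff)
    show "\<forall>\<^sub>F y in at x within {a..b}. 0 \<le> (\<phi> y - \<phi> x) / (y - x)"
      unfolding eventually_at_filter
    proof (intro always_eventually allI impI)
      fix y assume "y \<noteq> x" "y \<in> {a..b}"
      then show "0 \<le> (\<phi> y - \<phi> x) / (y - x)"
        using le[of x y] le[of y x] x by (cases "x \<le> y") (auto simp: zero_le_divide_iff)
    qed
    show "at x within {a..b} \<noteq> bot"
      using islimpt_Icc[OF ab, of x] x by (simp add: trivial_limit_within)
  qed
  have [measurable]: "\<phi> \<in> borel_measurable M" "\<phi>' \<in> borel_measurable M" "(\<lambda>x. x) \<in> borel_measurable M"
    unfolding M_def using cont cont'
    by (auto intro!: continuous_imp_measurable_on_sets_lebesgue)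
  have g_abs: "g absolutely_integrable_on {a..b}"
    using g g0 by (rule nonnegative_absolutely_integrable_1)
  have [measurable]: "g \<in> borel_measurable M"
    using g_abs by (simp add: M_def absolutely_integrable_measurable)
  \<comment> \<open>By monotonicity the integral in \<open>x\<close> is largest for
    \<open>t = a\<close>, which gives a bound independent of \<open>t\<close>.\<close>
  define C where "C = (\<phi> b - \<phi> a) powr s / s"
  define h where "h x t = indicator {..x} t * (ennreal (\<phi>' x * (\<phi> x - \<phi> t) powr (s - 1)) * ennreal (g t))" for x t
  interpret M: finite_measure M
    unfolding M_def by (intro finite_measure_lebesgue_on) auto
  interpret MM: pair_sigma_finite M M ..
  have hm [measurable]: "case_prod h \<in> borel_measurable (M \<Otimes>\<^sub>M M)"
  proof -
    have "(\<lambda>p. if snd p \<le> fst p then ennreal (\<phi>' (fst p) * (\<phi> (fst p) - \<phi> (snd p)) powr (s - 1)) * ennreal (g (snd p)) else 0)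
        \<in> borel_measurable (M \<Otimes>\<^sub>M M)"
      by measurable
    also have "?this \<longleftrightarrow> ?thesis"
      by (intro arg_cong[of _ _ "\<lambda>f. f \<in> _"]) (auto simp: h_def fun_eq_iff indicator_def)
    finally show ?thesis .
  qed
  have inner: "(\<integral>\<^sup>+ x. h x t \<partial>M) \<le> ennreal C * ennreal (g t)" if t: "t \<in> {a..b}" for t
  proof -
    let ?f = "\<lambda>x. \<phi>' x * (\<phi> x - \<phi> t) powr (s - 1)"
    have [measurable]: "{t..b} \<in> sets M"
      using t by (auto simp: M_def sets_restrict_space_iff)
    have "(\<integral>\<^sup>+ x. h x t \<partial>M) = (\<integral>\<^sup>+ x. (ennreal (?f x) * indicator {t..b} x) * ennreal (g t) \<partial>M)"
      by (intro nn_integral_cong) (auto simp: M_def h_def indicator_def)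
    also have "\<dots> = (\<integral>\<^sup>+ x. ennreal (?f x) * indicator {t..b} x \<partial>M) * ennreal (g t)"
      by (intro nn_integral_multc) measurable
    also have "(\<integral>\<^sup>+ x. ennreal (?f x) * indicator {t..b} x \<partial>M) = (\<integral>\<^sup>+ x. ennreal (?f x) * indicator {t..b} x \<partial>lborel)"
      unfolding M_def using t
      by (subst nn_integral_restrict_space)
        (auto simp: nn_integral_completion indicator_def intro!: nn_integral_cong)
    also have "\<dots> = ennreal ((\<phi> b - \<phi> t) powr s / s)"
      using t deriv_nonneg
      by (intro nn_integral_has_integral_lebesgue' powr_diff_has_integral[OF deriv mono s t]) auto
    also have "\<dots> \<le> ennreal C"
      unfolding C_def using s t le[of a t] le[of t b]
      by (intro ennreal_leI divide_right_mono powr_mono2) auto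
    finally show ?thesis by (simp add: mult_right_mono)
  qed
  have "(\<integral>\<^sup>+ x. (\<integral>\<^sup>+ t. h x t \<partial>M) \<partial>M) = (\<integral>\<^sup>+ t. (\<integral>\<^sup>+ x. h x t \<partial>M) \<partial>M)"
    by (rule MM.Fubini'[symmetric, OF hm])
  also have "\<dots> \<le> (\<integral>\<^sup>+ t. ennreal C * ennreal (g t) \<partial>M)"
    by (intro nn_integral_mono inner) (auto simp: M_def)
  also have "\<dots> = ennreal C * (\<integral>\<^sup>+ t. ennreal (g t) \<partial>M)"
    by (intro nn_integral_cmult) measurable
  also have "(\<integral>\<^sup>+ t. ennreal (g t) \<partial>M) = ennreal (integral {a..b} g)"
    unfolding M_def using nn_integral_has_integral_lebesgue'[OF g0 integrable_integral[OF g]]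
    by (subst nn_integral_restrict_space) (auto simp: nn_integral_completion)
  finally have "(\<integral>\<^sup>+ x. (\<integral>\<^sup>+ t. h x t \<partial>M) \<partial>M) \<noteq> \<infinity>"
    by (auto simp: top_unique ennreal_mult_eq_top_iff)
  then have "AE x in M. (\<integral>\<^sup>+ t. h x t \<partial>M) \<noteq> \<infinity>"
    by (intro nn_integral_PInf_AE M.borel_measurable_nn_integral hm) auto
  then have "AE x in lebesgue. x \<in> {a..b} \<longrightarrow> (\<integral>\<^sup>+ t. h x t \<partial>M) \<noteq> \<infinity>"
    unfolding M_def by (subst (asm) AE_restrict_space_iff) auto
  then show ?thesis
  proof (rule AE_mp, intro AE_I2 impI)
    fix x assume fin: "x \<in> {a..b} \<longrightarrow> (\<integral>\<^sup>+ t. h x t \<partial>M) \<noteq> \<infinity>" and x: "x \<in> {a..b} \<and> \<phi>' x \<noteq> 0"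
    let ?f = "\<lambda>t. (\<phi> x - \<phi> t) powr (s - 1) * g t"
    have pos: "\<phi>' x > 0" using x deriv_nonneg[of x] by auto
    have [measurable]: "{a..x} \<in> sets M"
      using x by (auto simp: M_def sets_restrict_space_iff)
    have "(\<integral>\<^sup>+ t. h x t \<partial>M) = (\<integral>\<^sup>+ t. ennreal (\<phi>' x) * (ennreal (?f t) * indicator {a..x} t) \<partial>M)"
      using pos g0
      by (intro nn_integral_cong) (auto simp: M_def h_def indicator_def mult.assoc simp flip: ennreal_mult)
    also have "\<dots> = ennreal (\<phi>' x) * (\<integral>\<^sup>+ t. ennreal (?f t) * indicator {a..x} t \<partial>M)"
      by (intro nn_integral_cmult) measurable
    finally have fin': "(\<integral>\<^sup>+ t. ennreal (?f t) * indicator {a..x} t \<partial>M) \<noteq> \<infinity>"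
      using fin x pos by (auto simp: ennreal_mult_eq_top_iff)
    have "(\<integral>\<^sup>+ t. ennreal (?f t) * indicator {a..x} t \<partial>M) = (\<integral>\<^sup>+ t. ennreal (norm (indicator {a..x} t *\<^sub>R ?f t)) \<partial>M)"
      using g0 by (intro nn_integral_cong) (auto simp: M_def indicator_def abs_mult)
    with fin' have "integrable M (\<lambda>t. indicator {a..x} t *\<^sub>R ?f t)"
      by (intro integrableI_bounded) (auto simp: less_top)
    then have "integrable lebesgue (\<lambda>t. indicator {a..b} t *\<^sub>R (indicator {a..x} t *\<^sub>R ?f t))"
      unfolding M_def by (subst (asm) integrable_restrict_space) auto
    also have "(\<lambda>t. indicator {a..b} t *\<^sub>R (indicator {a..x} t *\<^sub>R ?f t)) = (\<lambda>t. indicator {a..x} t *\<^sub>R ?f t)"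
      using x by (auto simp: indicator_def fun_eq_iff)
    finally have "?f absolutely_integrable_on {a..x}"
      by (simp add: set_integrable_def)
    then show "?f integrable_on {a..x}"
      by (rule set_lebesgue_integral_eq_integral(1))
  qed
qed

text \<open>The decreasing case is the increasing one for \<open>- \<phi>\<close>, with derivative
  \<open>- \<phi>'\<close>.\<close>

lemma AE_abs_powr_diff_integrable:
  fixes \<phi> :: "real \<Rightarrow> real"
  assumes deriv: "\<And>x. x \<in> {a..b} \<Longrightarrow> (\<phi> has_real_derivative \<phi>' x) (at x within {a..b})"
    and cont': "continuous_on {a..b} \<phi>'"
    and ab: "a < b" and mono: "mono_on {a..b} \<phi> \<or> antimono_on {a..b} \<phi>" and s: "s > 0"
    and g: "g integrable_on {a..b}" and g0: "\<And>t. t \<in> {a..b} \<Longrightarrow> 0 \<le> g t"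
  shows "AE x in lebesgue. x \<in> {a..b} \<and> \<phi>' x \<noteq> 0 \<longrightarrow>
           (\<lambda>t. \<bar>\<phi> x - \<phi> t\<bar> powr (s - 1) * g t) integrable_on {a..x}"
  using mono
proof
  assume m: "mono_on {a..b} \<phi>"
  have "AE x in lebesgue. x \<in> {a..b} \<and> \<phi>' x \<noteq> 0 \<longrightarrow>
           (\<lambda>t. (\<phi> x - \<phi> t) powr (s - 1) * g t) integrable_on {a..x}"
    by (rule AE_powr_diff_integrable[OF deriv cont' ab m s g g0])
  then show ?thesis
  proof (rule AE_mp, intro AE_I2 impI)
    fix x assume *: "x \<in> {a..b} \<and> \<phi>' x \<noteq> 0 \<longrightarrow>
           (\<lambda>t. (\<phi> x - \<phi> t) powr (s - 1) * g t) integrable_on {a..x}"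
      and x: "x \<in> {a..b} \<and> \<phi>' x \<noteq> 0"
    from * x have "(\<lambda>t. (\<phi> x - \<phi> t) powr (s - 1) * g t) integrable_on {a..x}" by blast
    then show "(\<lambda>t. \<bar>\<phi> x - \<phi> t\<bar> powr (s - 1) * g t) integrable_on {a..x}"
      by (rule integrable_eq) (use m x in \<open>auto simp: mono_on_def\<close>)
  qed
next
  assume m: "antimono_on {a..b} \<phi>"
  have m': "mono_on {a..b} (\<lambda>x. - \<phi> x)"
    using m by (auto simp: monotone_on_def)
  have "AE x in lebesgue. x \<in> {a..b} \<and> - \<phi>' x \<noteq> 0 \<longrightarrow>
           (\<lambda>t. (- \<phi> x - - \<phi> t) powr (s - 1) * g t) integrable_on {a..x}"
    using cont'
    by (intro AE_powr_diff_integrable[OF DERIV_minus[OF deriv] _ ab m' s g g0] continuous_on_minus)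
  then show ?thesis
  proof (rule AE_mp, intro AE_I2 impI)
    fix x assume *: "x \<in> {a..b} \<and> - \<phi>' x \<noteq> 0 \<longrightarrow>
           (\<lambda>t. (- \<phi> x - - \<phi> t) powr (s - 1) * g t) integrable_on {a..x}"
      and x: "x \<in> {a..b} \<and> \<phi>' x \<noteq> 0"
    from * x have "(\<lambda>t. (- \<phi> x - - \<phi> t) powr (s - 1) * g t) integrable_on {a..x}" by simp
    then show "(\<lambda>t. \<bar>\<phi> x - \<phi> t\<bar> powr (s - 1) * g t) integrable_on {a..x}"
      by (rule integrable_eq) (use m x in \<open>auto simp: monotone_on_def\<close>)
  qed
qed

section \<open>Estimates for monotone \<open>\<phi>\<close> in both directions\<close>

locale monotone_kernel =
  fixes a b :: real and \<phi> \<phi>' :: "real \<Rightarrow> real" and u :: "real \<Rightarrow> complex"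
  assumes ab: "a < b"
    and deriv: "x \<in> {a..b} \<Longrightarrow> (\<phi> has_real_derivative \<phi>' x) (at x within {a..b})"
    and cont': "continuous_on {a..b} \<phi>'"
    and mono: "mono_on {a..b} \<phi> \<or> antimono_on {a..b} \<phi>"
    and u: "u \<in> L1_wrt a b \<phi>'"
begin

text \<open>For decreasing \<open>\<phi>\<close> the base of the power is negative, with argument \<open>pi\<close>.\<close>

definition phase :: "complex \<Rightarrow> real" where
  "phase s = (if mono_on {a..b} \<phi> then 1 else exp (- pi * Im s))"

text \<open>The integrable density behind all dominations. The absolute value covers decreasing
  \<open>\<phi>\<close>, where \<open>\<phi>'\<close> is nonpositive.\<close>

definition weight :: "real \<Rightarrow> real" where
  "weight t = \<bar>\<phi>' t\<bar> * cmod (u t)"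

lemma phase_pos: "phase s > 0"
  by (simp add: phase_def)

lemma weight_nonneg: "0 \<le> weight t"
  by (simp add: weight_def)

lemma cont: "continuous_on {a..b} \<phi>"
  using deriv by (rule DERIV_continuous_on)

text \<open>Used with \<open>y = x\<close> for bounds at a single point and with
  \<open>y = b\<close> for bounds uniform in \<open>x\<close>.\<close>

lemma abs_diff_le:
  assumes "a \<le> t" "t \<le> x" "x \<le> y" "y \<le> b"
  shows "\<bar>\<phi> x - \<phi> t\<bar> \<le> \<bar>\<phi> y - \<phi> a\<bar>"
  using mono
proof
  assume "mono_on {a..b} \<phi>"
  then have "\<phi> a \<le> \<phi> t" "\<phi> t \<le> \<phi> x" "\<phi> x \<le> \<phi> y"
    using assms by (auto simp: monotone_on_def)
  then show ?thesis by simp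
next
  assume "antimono_on {a..b} \<phi>"
  then have "\<phi> a \<ge> \<phi> t" "\<phi> t \<ge> \<phi> x" "\<phi> x \<ge> \<phi> y"
    using assms by (auto simp: monotone_on_def)
  then show ?thesis by simp
qed

text \<open>The difference does not change sign for \<open>t \<le> x\<close>, so its argument
  contributes one constant factor. Where the difference is 0 both sides are 0.\<close>

lemma norm_diff_powr:
  assumes "x \<le> b" "t \<in> {a..x}"
  shows "cmod (of_real (\<phi> x - \<phi> t) powr s) = \<bar>\<phi> x - \<phi> t\<bar> powr Re s * phase s"
proof (cases "mono_on {a..b} \<phi>")
  case True
  then have "\<phi> t \<le> \<phi> x" using assms by (auto simp: monotone_on_def)
  then show ?thesis
    using True by (subst norm_complex_of_real_powr) (simp add: phase_def)
next
  case False
  then have "antimono_on {a..b} \<phi>" using mono by blast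
  then have "\<phi> t \<ge> \<phi> x" using assms by (auto simp: monotone_on_def)
  then show ?thesis
    using False by (subst norm_complex_of_real_powr) (auto simp add: phase_def)
qed

lemma norm_diff_powr_le:
  assumes "a \<le> t" "t \<le> x" "x \<le> y" "y \<le> b" "0 \<le> Re s"
  shows "cmod (of_real (\<phi> x - \<phi> t) powr s) \<le> \<bar>\<phi> y - \<phi> a\<bar> powr Re s * phase s"
  using assms abs_diff_le[of t x y] phase_pos[of s]
  by (subst norm_diff_powr) (auto intro!: mult_right_mono powr_mono2)

lemma weight_integrable: "weight integrable_on {a..b}"
proof -
  have "(\<lambda>x. cmod (u x) * \<phi>' x) absolutely_integrable_on {a..b}"
    using u by (simp add: L1_wrt_def)
  then have "(\<lambda>x. norm (cmod (u x) * \<phi>' x)) integrable_on {a..b}"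
    by (simp add: absolutely_integrable_on_def)
  then show ?thesis
    by (rule integrable_eq) (auto simp: weight_def abs_mult)
qed

lemma weight_integrable_upto: "x \<le> b \<Longrightarrow> weight integrable_on {a..x}"
  by (rule integrable_on_subinterval[OF weight_integrable]) auto

lemma measurable_upto:
  assumes "x \<le> b"
  shows "u \<in> borel_measurable (lebesgue_on {a..x})"
    and "\<phi> \<in> borel_measurable (lebesgue_on {a..x})"
    and "\<phi>' \<in> borel_measurable (lebesgue_on {a..x})"
proof -
  have sub: "{a..x} \<subseteq> {a..b}" using assms by auto
  show "u \<in> borel_measurable (lebesgue_on {a..x})"
    using u sub by (auto simp: L1_wrt_def intro: measurable_restrict_mono)
  show "\<phi> \<in> borel_measurable (lebesgue_on {a..x})" "\<phi>' \<in> borel_measurable (lebesgue_on {a..x})"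
    using continuous_on_subset[OF cont sub] continuous_on_subset[OF cont' sub]
    by (auto intro!: continuous_imp_measurable_on_sets_lebesgue)
qed

lemma RL_integrand_measurable:
  assumes "x \<le> b"
  shows "RL_integrand \<mu> \<phi> \<phi>' u x \<in> borel_measurable (lebesgue_on {a..x})"
proof -
  note [measurable] = measurable_upto[OF assms]
  show ?thesis unfolding RL_integrand_def[abs_def] by measurable
qed

end

section \<open>Integrability and expansion for an analytic kernel\<close>

locale analytic_kernel = monotone_kernel +
  fixes \<alpha> \<beta> :: complex and R :: real and A :: "complex \<Rightarrow> complex" and c :: "nat \<Rightarrow> complex"
  assumes \<alpha>: "0 < Re \<alpha>" and \<beta>: "0 < Re \<beta>" and R: "0 < R"
    and sums: "cmod z < R \<Longrightarrow> (\<lambda>n. c n * z ^ n) sums A z"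
begin

abbreviation admissible :: "real set" where
  "admissible \<equiv> kernel_admissible a b R \<beta> \<phi>"

abbreviation domain :: "real set" where
  "domain \<equiv> kernel_domain a b R A \<alpha> \<beta> \<phi> \<phi>' u"

abbreviation kernel :: "real \<Rightarrow> real \<Rightarrow> complex" where
  "kernel \<equiv> kernel_integrand A \<alpha> \<beta> \<phi> \<phi>' u"

abbreviation RL :: "nat \<Rightarrow> real \<Rightarrow> real \<Rightarrow> complex" where
  "RL n \<equiv> RL_integrand (\<beta> * of_nat n + \<alpha>) \<phi> \<phi>' u"

abbreviation arg :: "real \<Rightarrow> real \<Rightarrow> complex" where
  "arg x t \<equiv> of_real (\<phi> x - \<phi> t) powr \<beta>"

text \<open>For \<open>x\<close> in \<open>{a..b}\<close> this is the norm of
  \<open>arg x a\<close>, the largest among all \<open>arg x t\<close>. Admissibility puts it below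
  \<open>R\<close>, and the closed formula shows its continuity in \<open>x\<close>.\<close>

definition radius :: "real \<Rightarrow> real" where
  "radius x = \<bar>\<phi> x - \<phi> a\<bar> powr Re \<beta> * phase \<beta>"

lemma admissibleD: "x \<in> admissible \<Longrightarrow> a \<le> x \<and> x \<le> b"
  by (simp add: kernel_admissible_def)

lemma domainD:
  assumes "x \<in> domain"
  shows "x \<in> admissible" "kernel x absolutely_integrable_on {a..x}"
  using assms by (auto simp: kernel_domain_def)

lemma norm_arg_le: "a \<le> t \<Longrightarrow> t \<le> x \<Longrightarrow> x \<le> b \<Longrightarrow> cmod (arg x t) \<le> radius x"
  unfolding radius_def using \<beta> by (intro norm_diff_powr_le) auto

lemma radius_less: "x \<in> admissible \<Longrightarrow> radius x < R"
  unfolding radius_def kernel_admissible_def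
  by (subst norm_diff_powr[symmetric]) auto

lemma radius_nonneg: "0 \<le> radius x"
  using phase_pos[of \<beta>] by (simp add: radius_def)

lemma continuous_radius: "continuous_on {a..b} radius"
  unfolding radius_def[abs_def] using \<beta>
  by (intro continuous_intros continuous_on_powr' cont) auto

lemma RL_eq:
  "RL n x t = of_real (\<phi>' t) * of_real (\<phi> x - \<phi> t) powr (\<alpha> - 1) * arg x t ^ n * u t"
  unfolding RL_integrand_def by (subst powr_mult_of_nat_add) (simp add: mult.assoc)

lemma norm_RL:
  "cmod (RL n x t) = weight t * cmod (of_real (\<phi> x - \<phi> t) powr (\<alpha> - 1)) * cmod (arg x t) ^ n"
  by (simp add: RL_eq weight_def norm_mult norm_power)

lemma norm_RL':
  "cmod (RL n x t) = weight t * cmod (of_real (\<phi> x - \<phi> t) powr (\<beta> * of_nat n + \<alpha> - 1))"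
  by (simp add: RL_integrand_def weight_def norm_mult)

lemma norm_kernel:
  "cmod (kernel x t) = weight t * cmod (of_real (\<phi> x - \<phi> t) powr (\<alpha> - 1)) * cmod (A (arg x t))"
  by (simp add: kernel_integrand_def weight_def norm_mult)

text \<open>On the disc \<open>A\<close> is the pointwise limit of polynomials, and admissibility
  keeps every argument inside the disc.\<close>

lemma kernel_measurable:
  assumes x: "x \<in> admissible"
  shows "kernel x \<in> borel_measurable (lebesgue_on {a..x})"
proof -
  have xb: "x \<le> b" using admissibleD[OF x] by simp
  note [measurable] = measurable_upto[OF xb]
  have [measurable]: "(\<lambda>t. A (arg x t)) \<in> borel_measurable (lebesgue_on {a..x})"
  proof (rule borel_measurable_LIMSEQ_metric)
    show "(\<lambda>t. \<Sum>n<N. c n * arg x t ^ n) \<in> borel_measurable (lebesgue_on {a..x})" for N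
      by measurable
    show "(\<lambda>N. \<Sum>n<N. c n * arg x t ^ n) \<longlonglongrightarrow> A (arg x t)"
      if "t \<in> space (lebesgue_on {a..x})" for t
      using sums[of "arg x t"] x that by (auto simp: sums_def kernel_admissible_def)
  qed
  show ?thesis unfolding kernel_integrand_def[abs_def] by measurable
qed

text \<open>Where \<open>arg x t\<close> is small, the lower bound on \<open>A\<close> compares the
  term with the kernel; \<open>c n \<noteq> 0\<close> gives \<open>n \<ge> k\<close>, and the
  surplus powers are bounded. Elsewhere \<open>\<bar>\<phi> x - \<phi> t\<bar>\<close> stays away
  from 0, so the power is bounded and \<open>weight\<close> dominates.\<close>

lemma RL_absolutely_integrable:
  assumes x: "x \<in> domain" and n: "c n \<noteq> 0"
  shows "RL n x absolutely_integrable_on {a..x}"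
proof -
  define k where "k = (LEAST n. c n \<noteq> 0)"
  have k: "c k \<noteq> 0" "\<And>m. m < k \<Longrightarrow> c m = 0" "k \<le> n"
    unfolding k_def using n
    by (fact LeastI[of "\<lambda>n. c n \<noteq> 0"], blast dest: not_less_Least, rule Least_le)
  obtain \<delta> K where \<delta>: "0 < \<delta>" "0 < K"
    and K: "\<And>z. cmod z \<le> \<delta> \<Longrightarrow> cmod z ^ k \<le> K * cmod (A z)"
    using power_series_lower_bound[OF sums R k(1,2)] by blast
  have xb: "a \<le> x" "x \<le> b" using admissibleD[OF domainD(1)[OF x]] by auto
  define e where "e = Re (\<beta> * of_nat n + \<alpha> - 1)"
  \<comment> \<open>The size of \<open>\<phi> x - \<phi> t\<close> at which \<open>arg x t\<close>
    has norm \<open>\<delta>\<close>.\<close>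
  define d where "d = (\<delta> / phase \<beta>) powr (1 / Re \<beta>)"
  \<comment> \<open>Adding the powers at both ends of the range covers either sign of the exponent
    \<open>e\<close>.\<close>
  define C where "C = (\<bar>\<phi> x - \<phi> a\<bar> powr e + d powr e) * phase (\<beta> * of_nat n + \<alpha> - 1)"
  have C: "0 \<le> C" using phase_pos[of "\<beta> * of_nat n + \<alpha> - 1"] by (simp add: C_def)
  have bound: "cmod (RL n x t) \<le> \<delta> ^ (n - k) * K * cmod (kernel x t) + C * weight t"
    if t: "t \<in> {a..x}" for t
  proof (cases "cmod (arg x t) \<le> \<delta>")
    case True
    have "cmod (arg x t) ^ n = cmod (arg x t) ^ (n - k) * cmod (arg x t) ^ k"
      using k(3) by (simp flip: power_add)
    also have "\<dots> \<le> \<delta> ^ (n - k) * (K * cmod (A (arg x t)))"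
      using True K[OF True] \<delta> by (intro mult_mono power_mono) auto
    finally have "cmod (RL n x t) \<le>
        weight t * cmod (of_real (\<phi> x - \<phi> t) powr (\<alpha> - 1)) * (\<delta> ^ (n - k) * (K * cmod (A (arg x t))))"
      unfolding norm_RL by (intro mult_left_mono mult_nonneg_nonneg weight_nonneg norm_ge_zero)
    also have "\<dots> = \<delta> ^ (n - k) * K * cmod (kernel x t)"
      unfolding norm_kernel by (simp only: mult_ac)
    finally have "cmod (RL n x t) \<le> \<delta> ^ (n - k) * K * cmod (kernel x t)" .
    moreover have "0 \<le> C * weight t" using C weight_nonneg by simp
    ultimately show ?thesis by linarith
  next
    case False
    define D where "D = \<bar>\<phi> x - \<phi> t\<bar>"
    have "\<delta> < D powr Re \<beta> * phase \<beta>"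
      using False norm_diff_powr[OF xb(2) t, of \<beta>] by (simp add: D_def)
    then have lt: "\<delta> / phase \<beta> < D powr Re \<beta>"
      using phase_pos[of \<beta>] by (simp add: field_simps)
    then have "d \<le> (D powr Re \<beta>) powr (1 / Re \<beta>)"
      unfolding d_def using \<delta> \<beta> phase_pos[of \<beta>] by (intro powr_mono2) auto
    then have dD: "d \<le> D" using \<beta> by (simp add: powr_powr D_def)
    have d: "0 < d" using \<delta> phase_pos[of \<beta>] by (simp add: d_def)
    have DB: "D \<le> \<bar>\<phi> x - \<phi> a\<bar>" unfolding D_def using t xb by (intro abs_diff_le) auto
    have "D powr e \<le> \<bar>\<phi> x - \<phi> a\<bar> powr e + d powr e"
    proof (cases "0 \<le> e")
      case True
      then have "D powr e \<le> \<bar>\<phi> x - \<phi> a\<bar> powr e" using DB d dD by (intro powr_mono2) auto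
      then show ?thesis by (simp add: add_increasing2)
    next
      case False
      then have "D powr e \<le> d powr e" using d dD by (intro powr_mono2') auto
      then show ?thesis by (simp add: add_increasing)
    qed
    then have "cmod (of_real (\<phi> x - \<phi> t) powr (\<beta> * of_nat n + \<alpha> - 1)) \<le> C"
      unfolding norm_diff_powr[OF xb(2) t] C_def D_def e_def
      by (intro mult_right_mono less_imp_le[OF phase_pos])
    then have "cmod (RL n x t) \<le> C * weight t"
      unfolding norm_RL' using weight_nonneg[of t] by (metis mult.commute mult_right_mono)
    moreover have "0 \<le> \<delta> ^ (n - k) * K * cmod (kernel x t)" using \<delta> by simp
    ultimately show ?thesis by linarith
  qed
  have "(\<lambda>t. cmod (kernel x t)) integrable_on {a..x}"
    using domainD(2)[OF x] by (simp add: absolutely_integrable_on_def)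
  then have "(\<lambda>t. \<delta> ^ (n - k) * K * cmod (kernel x t) + C * weight t) integrable_on {a..x}"
    by (intro integrable_add integrable_on_mult_right weight_integrable_upto xb)
  then show ?thesis
    using bound by (intro measurable_bounded_by_integrable_imp_absolutely_integrable
        [OF RL_integrand_measurable[OF xb(2)]]) auto
qed

text \<open>For fixed admissible \<open>x\<close> the factors \<open>A (arg x t)\<close> and
  \<open>arg x t ^ n\<close> are bounded in \<open>t\<close>, so the model integral with exponent
  \<open>Re \<alpha> - 1\<close> dominates everything.\<close>

lemma AE_domain:
  "AE x in lebesgue. x \<in> admissible \<and> \<phi>' x \<noteq> 0 \<longrightarrow>
     x \<in> domain \<and> (\<forall>n. RL n x absolutely_integrable_on {a..x})"
proof -
  have "AE x in lebesgue. x \<in> {a..b} \<and> \<phi>' x \<noteq> 0 \<longrightarrow>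
           (\<lambda>t. \<bar>\<phi> x - \<phi> t\<bar> powr (Re \<alpha> - 1) * weight t) integrable_on {a..x}"
    by (rule AE_abs_powr_diff_integrable[OF deriv cont' ab mono \<alpha> weight_integrable weight_nonneg])
  then show ?thesis
  proof (rule AE_mp, intro AE_I2 impI)
    fix x assume *: "x \<in> {a..b} \<and> \<phi>' x \<noteq> 0 \<longrightarrow>
           (\<lambda>t. \<bar>\<phi> x - \<phi> t\<bar> powr (Re \<alpha> - 1) * weight t) integrable_on {a..x}"
      and x: "x \<in> admissible \<and> \<phi>' x \<noteq> 0"
    have xb: "a \<le> x" "x \<le> b" using admissibleD x by auto
    let ?g = "\<lambda>t. \<bar>\<phi> x - \<phi> t\<bar> powr (Re \<alpha> - 1) * weight t"
    have g: "?g integrable_on {a..x}" using * x xb by auto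
    have base: "weight t * cmod (of_real (\<phi> x - \<phi> t) powr (\<alpha> - 1)) = phase (\<alpha> - 1) * ?g t"
      if "t \<in> {a..x}" for t
      using that xb by (subst norm_diff_powr) auto
    obtain r where r: "radius x < r" "r < R"
      using dense[OF radius_less] x by blast
    have r0: "0 < r" using r radius_nonneg[of x] by linarith
    obtain E where E: "\<And>N. 0 \<le> E N" "\<And>k N z. k \<le> N \<Longrightarrow> cmod z \<le> r \<Longrightarrow>
       cmod (A z - (\<Sum>n<N. c n * z ^ n)) \<le> E N * (cmod z / r) ^ k"
      using power_series_tail_bound[OF sums r0 r(2)] by metis
    have arg_le: "cmod (arg x t) \<le> r" if "t \<in> {a..x}" for t
      using norm_arg_le[of t x] that xb r by auto
    have "kernel x absolutely_integrable_on {a..x}"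
    proof (rule measurable_bounded_by_integrable_imp_absolutely_integrable)
      show "kernel x \<in> borel_measurable (lebesgue_on {a..x})"
        using x by (intro kernel_measurable) simp
      show "(\<lambda>t. phase (\<alpha> - 1) * ?g t * E 0) integrable_on {a..x}"
        by (intro integrable_on_mult_right integrable_on_mult_left g)
      \<comment> \<open>With \<open>N = 0\<close> and \<open>k = 0\<close> the partial sum is empty,
        and the tail estimate bounds \<open>A\<close> itself by \<open>E 0\<close>.\<close>
      show "cmod (kernel x t) \<le> phase (\<alpha> - 1) * ?g t * E 0" if t: "t \<in> {a..x}" for t
        unfolding norm_kernel base[OF t] using E(2)[of 0 0 "arg x t"] arg_le[OF t] weight_nonneg phase_pos[of "\<alpha> - 1"]
        by (intro mult_left_mono mult_nonneg_nonneg) auto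
    qed auto
    moreover have "RL n x absolutely_integrable_on {a..x}" for n
    proof (rule measurable_bounded_by_integrable_imp_absolutely_integrable)
      show "RL n x \<in> borel_measurable (lebesgue_on {a..x})"
        by (intro RL_integrand_measurable xb)
      show "(\<lambda>t. phase (\<alpha> - 1) * ?g t * r ^ n) integrable_on {a..x}"
        by (intro integrable_on_mult_right integrable_on_mult_left g)
      show "cmod (RL n x t) \<le> phase (\<alpha> - 1) * ?g t * r ^ n" if t: "t \<in> {a..x}" for t
        unfolding norm_RL base[OF t] using arg_le[OF t] weight_nonneg phase_pos[of "\<alpha> - 1"]
        by (intro mult_left_mono mult_nonneg_nonneg power_mono) auto
    qed auto
    ultimately show "x \<in> domain \<and> (\<forall>n. RL n x absolutely_integrable_on {a..x})"
      using x by (simp add: kernel_domain_def)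
  qed
qed

lemma partial_sum_eq:
  assumes x: "x \<in> domain"
  shows "(\<lambda>t. \<Sum>n<N. c n * RL n x t) absolutely_integrable_on {a..x}"
    and "(\<Sum>n<N. c n * Gamma (\<beta> * of_nat n + \<alpha>) * RL_integral a (\<beta> * of_nat n + \<alpha>) \<phi> \<phi>' u x) =
      (LINT t:{a..x}|lebesgue. \<Sum>n<N. c n * RL n x t)"
proof -
  have int: "(\<lambda>t. c n * RL n x t) absolutely_integrable_on {a..x}" for n
  proof (cases "c n = 0")
    case False
    then show ?thesis by (intro set_integrable_mult_right RL_absolutely_integrable[OF x])
  qed auto
  then show "(\<lambda>t. \<Sum>n<N. c n * RL n x t) absolutely_integrable_on {a..x}"
    by (intro absolutely_integrable_sum) auto
  have "c n * Gamma (\<beta> * of_nat n + \<alpha>) * RL_integral a (\<beta> * of_nat n + \<alpha>) \<phi> \<phi>' u x =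
      (LINT t:{a..x}|lebesgue. c n * RL n x t)" for n
  proof -
    \<comment> \<open>\<open>Gamma\<close> takes the default value 0 at its poles; a positive real
      part avoids them, so the factor cancels the one in \<open>RL_integral\<close>.\<close>
    have "Re (\<beta> * of_nat n + \<alpha>) > 0" using \<alpha> \<beta> by (simp add: add_nonneg_pos)
    then have "\<beta> * of_nat n + \<alpha> \<notin> \<int>\<^sub>\<le>\<^sub>0"
      by (metis nonpos_Ints_cases complex_Re_of_int not_less of_int_le_0_iff)
    then have "Gamma (\<beta> * of_nat n + \<alpha>) \<noteq> 0" by (simp add: Gamma_eq_zero_iff)
    then show ?thesis by (simp add: RL_integral_def)
  qed
  then have "(\<Sum>n<N. c n * Gamma (\<beta> * of_nat n + \<alpha>) * RL_integral a (\<beta> * of_nat n + \<alpha>) \<phi> \<phi>' u x) =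
      (\<Sum>n<N. LINT t:{a..x}|lebesgue. c n * RL n x t)" by (simp only:)
  also have "\<dots> = (LINT t:{a..x}|lebesgue. \<Sum>n<N. c n * RL n x t)"
    using int unfolding set_lebesgue_integral_def set_integrable_def
    by (subst Bochner_Integration.integral_sum[symmetric]) (auto simp: scaleR_sum_right)
  finally show "(\<Sum>n<N. c n * Gamma (\<beta> * of_nat n + \<alpha>) * RL_integral a (\<beta> * of_nat n + \<alpha>) \<phi> \<phi>' u x) =
      (LINT t:{a..x}|lebesgue. \<Sum>n<N. c n * RL n x t)" .
qed

lemma sums_locally_uniformly:
  "sums_locally_uniformly_on domain
     (\<lambda>n x. c n * Gamma (\<beta> * of_nat n + \<alpha>) * RL_integral a (\<beta> * of_nat n + \<alpha>) \<phi> \<phi>' u x)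
     (kernel_integral a A \<alpha> \<beta> \<phi> \<phi>' u)"
  unfolding sums_locally_uniformly_on_def
proof
  fix x0 assume x0: "x0 \<in> domain"
  obtain r where r: "radius x0 < r" "r < R"
    using dense[OF radius_less[OF domainD(1)[OF x0]]] by blast
  have r0: "0 < r" using r radius_nonneg[of x0] by linarith
  obtain E where E: "E \<longlonglongrightarrow> 0" "\<And>N. 0 \<le> E N" "\<And>k N z. k \<le> N \<Longrightarrow> cmod z \<le> r \<Longrightarrow>
       cmod (A z - (\<Sum>n<N. c n * z ^ n)) \<le> E N * (cmod z / r) ^ k"
    using power_series_tail_bound[OF sums r0 r(2)] by metis
  \<comment> \<open>Near \<open>x0\<close> a single \<open>r\<close>, and hence a single sequence
    \<open>E\<close>, serves all points.\<close>
  have "\<forall>\<^sub>F x in at x0 within {a..b}. radius x < r"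
    using continuous_radius r(1) admissibleD[OF domainD(1)[OF x0]]
    by (intro order_tendstoD) (auto simp: continuous_on_def)
  then obtain e where e: "e > 0" "\<And>x. x \<in> {a..b} \<Longrightarrow> dist x x0 < e \<Longrightarrow> radius x < r"
    using r(1) unfolding eventually_at by (metis)
  \<comment> \<open>Chosen so that \<open>\<beta> * of_nat k + \<alpha> - 1\<close> has nonnegative
    real part, which turns the singular power into a bounded one.\<close>
  obtain k :: nat where k: "(1 - Re \<alpha>) / Re \<beta> \<le> of_nat k"
    using real_arch_simple by blast
  define \<mu> where "\<mu> = \<beta> * of_nat k + \<alpha> - 1"
  have \<mu>: "0 \<le> Re \<mu>" using k \<beta> by (simp add: \<mu>_def field_simps)
  define C where "C = \<bar>\<phi> b - \<phi> a\<bar> powr Re \<mu> * phase \<mu> / r ^ k"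
  have C: "0 \<le> C" using r0 phase_pos[of \<mu>] by (simp add: C_def)
  define I where "I = integral {a..b} weight"
  have main: "cmod ((\<Sum>n<N. c n * Gamma (\<beta> * of_nat n + \<alpha>) * RL_integral a (\<beta> * of_nat n + \<alpha>) \<phi> \<phi>' u x) -
      kernel_integral a A \<alpha> \<beta> \<phi> \<phi>' u x) \<le> E N * C * I"
    if x: "x \<in> ball x0 e \<inter> domain" and N: "k \<le> N" for x N
  proof -
    have xd: "x \<in> domain" using x by simp
    have xb: "a \<le> x" "x \<le> b" using admissibleD[OF domainD(1)[OF xd]] by auto
    have rx: "radius x < r" using e(2)[of x] x xb by (auto simp: dist_commute)
    let ?d = "\<lambda>t. kernel x t - (\<Sum>n<N. c n * RL n x t)"
    have int: "?d absolutely_integrable_on {a..x}"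
      by (intro set_integral_diff domainD(2) partial_sum_eq xd)
    have bound: "cmod (?d t) \<le> E N * C * weight t" if t: "t \<in> {a..x}" for t
    proof -
      have "?d t = of_real (\<phi>' t) * of_real (\<phi> x - \<phi> t) powr (\<alpha> - 1) *
          (A (arg x t) - (\<Sum>n<N. c n * arg x t ^ n)) * u t"
        unfolding RL_eq kernel_integrand_def
        by (simp add: algebra_simps sum_distrib_left sum_distrib_right)
      then have "cmod (?d t) = weight t * cmod (of_real (\<phi> x - \<phi> t) powr (\<alpha> - 1)) *
          cmod (A (arg x t) - (\<Sum>n<N. c n * arg x t ^ n))"
        by (simp add: weight_def norm_mult)
      also have "\<dots> \<le> weight t * cmod (of_real (\<phi> x - \<phi> t) powr (\<alpha> - 1)) * (E N * (cmod (arg x t) / r) ^ k)"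
        using E(3)[OF N, of "arg x t"] norm_arg_le[of t x] t xb rx weight_nonneg[of t]
        by (intro mult_left_mono mult_nonneg_nonneg) auto
      \<comment> \<open>The factor \<open>arg x t ^ k\<close> from the tail merges with the singular
        power into the exponent \<open>\<mu>\<close>.\<close>
      also have "\<dots> = E N * weight t * cmod (of_real (\<phi> x - \<phi> t) powr \<mu>) / r ^ k"
        unfolding \<mu>_def powr_mult_of_nat_add by (simp add: norm_mult norm_power power_divide)
      also have "\<dots> \<le> E N * weight t * (\<bar>\<phi> b - \<phi> a\<bar> powr Re \<mu> * phase \<mu>) / r ^ k"
        using t xb \<mu> E(2) weight_nonneg r0
        by (intro divide_right_mono mult_left_mono norm_diff_powr_le mult_nonneg_nonneg) auto
      finally show ?thesis by (simp add: C_def mult_ac)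
    qed
    have "kernel_integral a A \<alpha> \<beta> \<phi> \<phi>' u x -
        (\<Sum>n<N. c n * Gamma (\<beta> * of_nat n + \<alpha>) * RL_integral a (\<beta> * of_nat n + \<alpha>) \<phi> \<phi>' u x) =
        (LINT t:{a..x}|lebesgue. ?d t)"
      unfolding kernel_integral_def partial_sum_eq(2)[OF xd]
      by (intro set_integral_diff(2)[symmetric] domainD(2) partial_sum_eq(1) xd)
    also have "\<dots> = integral {a..x} ?d"
      by (rule set_lebesgue_integral_eq_integral(2)[OF int])
    also have "cmod \<dots> \<le> integral {a..x} (\<lambda>t. E N * C * weight t)"
      using bound set_lebesgue_integral_eq_integral(1)[OF int]
      by (intro integral_norm_bound_integral integrable_on_mult_right weight_integrable_upto xb) auto
    also have "\<dots> = E N * C * integral {a..x} weight" by simp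
    \<comment> \<open>Enlarging the interval to \<open>{a..b}\<close> removes the last dependence on
      \<open>x\<close>.\<close>
    also have "\<dots> \<le> E N * C * I"
      unfolding I_def using E(2) C weight_integrable weight_integrable_upto[OF xb(2)] xb weight_nonneg
      by (intro mult_left_mono integral_subset_le mult_nonneg_nonneg) auto
    finally show ?thesis by (simp add: norm_minus_commute)
  qed
  have "uniform_limit (ball x0 e \<inter> domain)
      (\<lambda>N x. \<Sum>n<N. c n * Gamma (\<beta> * of_nat n + \<alpha>) * RL_integral a (\<beta> * of_nat n + \<alpha>) \<phi> \<phi>' u x)
      (kernel_integral a A \<alpha> \<beta> \<phi> \<phi>' u) sequentially"
  proof (rule uniform_limitI)
    fix \<epsilon> :: real assume "\<epsilon> > 0"
    moreover have "(\<lambda>N. E N * C * I) \<longlonglongrightarrow> 0 * C * I"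
      by (intro tendsto_intros E(1))
    ultimately have "\<forall>\<^sub>F N in sequentially. E N * C * I < \<epsilon>"
      by (intro order_tendstoD) auto
    then show "\<forall>\<^sub>F N in sequentially. \<forall>x\<in>ball x0 e \<inter> domain.
        dist (\<Sum>n<N. c n * Gamma (\<beta> * of_nat n + \<alpha>) * RL_integral a (\<beta> * of_nat n + \<alpha>) \<phi> \<phi>' u x)
          (kernel_integral a A \<alpha> \<beta> \<phi> \<phi>' u x) < \<epsilon>"
      using eventually_ge_at_top[of k]
    proof eventually_elim
      case (elim N)
      then show ?case using main[of _ N] unfolding dist_norm by (meson le_less_trans)
    qed
  qed
  with e(1) show "\<exists>e>0. uniform_limit (ball x0 e \<inter> domain)
      (\<lambda>N x. \<Sum>n<N. c n * Gamma (\<beta> * of_nat n + \<alpha>) * RL_integral a (\<beta> * of_nat n + \<alpha>) \<phi> \<phi>' u x)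
      (kernel_integral a A \<alpha> \<beta> \<phi> \<phi>' u) sequentially" by blast
qed

end

text \<open>Integrability of the kernel carries no information on orders with
  \<open>c n = 0\<close>, as \<open>A = 0\<close> shows; hence the restriction in the second claim.
  The third claim ensures that the domain contains almost every admissible point with
  \<open>\<phi>' x \<noteq> 0\<close>.\<close>

theorem theorem3p5:
  fixes a b R L :: real
    and \<alpha> \<beta> :: complex
    and c :: "nat \<Rightarrow> complex"
    and A :: "complex \<Rightarrow> complex"
    and \<phi> \<phi>' :: "real \<Rightarrow> real"
    and u :: "real \<Rightarrow> complex"
  assumes "a < b"
    and "Re \<alpha> > 0" and "Re \<beta> > 0"
    and "R > 0" and "R > (b - a) powr Re \<beta>"
    and "A analytic_on ball 0 R"
    and "sums_locally_uniformly_on (ball 0 R) (\<lambda>n z. c n * z ^ n) A"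
    and "\<And>x. x \<in> {a..b} \<Longrightarrow> (\<phi> has_real_derivative \<phi>' x) (at x within {a..b})"
    and "continuous_on {a..b} \<phi>'"
    and "mono_on {a..b} \<phi> \<or> antimono_on {a..b} \<phi>"
    and "L-lipschitz_on {a..b} \<phi>"
    and "u \<in> L1_wrt a b \<phi>'"
  shows "sums_locally_uniformly_on (kernel_domain a b R A \<alpha> \<beta> \<phi> \<phi>' u)
           (\<lambda>n x. c n * Gamma (\<beta> * of_nat n + \<alpha>) * RL_integral a (\<beta> * of_nat n + \<alpha>) \<phi> \<phi>' u x)
           (kernel_integral a A \<alpha> \<beta> \<phi> \<phi>' u) \<and>
         (\<forall>x \<in> kernel_domain a b R A \<alpha> \<beta> \<phi> \<phi>' u. \<forall>n. c n \<noteq> 0 \<longrightarrow>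
           RL_integrand (\<beta> * of_nat n + \<alpha>) \<phi> \<phi>' u x absolutely_integrable_on {a..x}) \<and>
         (AE x in lebesgue. x \<in> kernel_admissible a b R \<beta> \<phi> \<and> \<phi>' x \<noteq> 0 \<longrightarrow>
           x \<in> kernel_domain a b R A \<alpha> \<beta> \<phi> \<phi>' u \<and>
           (\<forall>n. RL_integrand (\<beta> * of_nat n + \<alpha>) \<phi> \<phi>' u x absolutely_integrable_on {a..x}))"
proof -
  \<comment> \<open>The neighbourhood of uniform convergence contains its centre \<open>z\<close>,
    so pointwise convergence follows.\<close>
  have "(\<lambda>n. c n * z ^ n) sums A z" if "cmod z < R" for z
  proof -
    obtain e where "e > 0"
      "uniform_limit (ball z e \<inter> ball 0 R) (\<lambda>N y. \<Sum>n<N. c n * y ^ n) A sequentially"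
      using assms(7) \<open>cmod z < R\<close> unfolding sums_locally_uniformly_on_def by force
    then show ?thesis
      using \<open>cmod z < R\<close> by (auto simp: sums_def intro: tendsto_uniform_limitI)
  qed
  then interpret analytic_kernel a b \<phi> \<phi>' u \<alpha> \<beta> R A c
    using assms by unfold_locales auto
  show ?thesis
    using sums_locally_uniformly RL_absolutely_integrable AE_domain by blast
qed

end
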